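(* Let $A,B$ be separable metric spaces of finite diameter. Let $\alpha^*$ be an ordinal such that $r^{A,B}_{\alpha^*+1,n}=r^{A,B}_{\alpha^*,n}$ for each $n\in\mathbb N$. Then $r^{A,B}_{\alpha^*,0}=d_{GH}(A,B)$.
   Context: For metric spaces $X,Y$, a bi-Katetov function is $f:X\times Y\to\mathbb R$ that is $1$-Lipschitz in each variable and satisfies $d_X(x,w)\le f(x,y)+f(w,y)$ and $d_Y(y,z)\le f(x,y)+f(x,z)$ for all $x,w\in X$, $y,z\in Y$ (equivalently, $f(x,y)=d_Z(i(x),j(y))$ for isometric embeddings $i,j$ into some metric space $Z$). The Gromov–Hausdorff distance $d_{GH}(X,Y)$ is the infimum of the Hausdorff distances of $i(X),j(Y)$ over all isometric embeddings $i:X\to Z$, $j:Y\to Z$ into a common metric space $Z$. For $n$-tuples $\bar a=(a_0,\dots,a_{n-1})\in A^n$, $\bar b\in B^n$ define $r^{A,B}_{0,n}(\bar a,\bar b)=\inf_f\max_{i<n}f(a_i,b_i)$, the infimum over bi-Katetov functions $f$ on $\{a_0,\dots,a_{n-1}\}\times\{b_0,\dots,b_{n-1}\}$ (with the max over the empty set being $0$); $r^{A,B}_{\alpha+1,n}(\bar a,\bar b)=\max\big(\sup_{x\in A}\inf_{y\in B}r^{A,B}_{\alpha,n+1}(\bar ax,\bar by),\ \sup_{y\in B}\inf_{x\in A}r^{A,B}_{\alpha,n+1}(\bar ax,\bar by)\big)$; and $r^{A,B}_{\alpha,n}=\sup_{\beta<\alpha}r^{A,B}_{\beta,n}$ for limit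 $\alpha$. *)

theory Defs
  imports "HOL-Analysis.Analysis"
begin

text \<open>Distances are collected in \<^typ>\<open>ennreal\<close>, a complete lattice, so that every infimum and
  supremum below is total: an infimum over the empty set is \<open>\<infinity>\<close> and a supremum over the
  empty set is \<open>0\<close>. For nonempty spaces of finite diameter all the values are finite and agree
  with the real-valued infima and suprema.\<close>

definition isometric_embedding :: "'a metric \<Rightarrow> 'z metric \<Rightarrow> ('a \<Rightarrow> 'z) \<Rightarrow> bool" where
  "isometric_embedding X Z i \<longleftrightarrow>
     i \<in> mspace X \<rightarrow> mspace Z \<and>
     (\<forall>x\<in>mspace X. \<forall>w\<in>mspace X. mdist Z (i x) (i w) = mdist X x w)"

definition hausdorff_dist :: "'z metric \<Rightarrow> 'z set \<Rightarrow> 'z set \<Rightarrow> ennreal" where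
  "hausdorff_dist Z S T =
     max (SUP s\<in>S. INF t\<in>T. ennreal (mdist Z s t)) (SUP t\<in>T. INF s\<in>S. ennreal (mdist Z s t))"

text \<open>A definition cannot quantify over the type of points of \<open>Z\<close>. The type \<^typ>\<open>'a + 'b\<close> is large
  enough for all spaces of the form \<open>i(X) \<union> j(Y)\<close>, the only part of \<open>Z\<close> that matters; that
  spaces \<open>Z\<close> over other types do not lower the infimum is \<open>gh_dist_le_hausdorff_dist\<close> below.\<close>

definition gh_dist :: "'a metric \<Rightarrow> 'b metric \<Rightarrow> ennreal" where
  "gh_dist X Y =
     Inf {hausdorff_dist Z (i ` mspace X) (j ` mspace Y) | (Z :: ('a + 'b) metric) i j.
            isometric_embedding X Z i \<and> isometric_embedding Y Z j}"

lemma gh_dist_le_hausdorff_dist: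
  fixes X :: "'a metric" and Y :: "'b metric" and Z :: "'z metric"
  assumes i: "isometric_embedding X Z i" and j: "isometric_embedding Y Z j"
  shows "gh_dist X Y \<le> hausdorff_dist Z (i ` mspace X) (j ` mspace Y)"
proof -
  define W where "W = i ` mspace X \<union> j ` mspace Y"
  define k :: "'z \<Rightarrow> 'a + 'b" where
    "k z = (if z \<in> i ` mspace X then Inl (inv_into (mspace X) i z)
            else Inr (inv_into (mspace Y) j z))" for z
  define l where "l p = (case p of Inl x \<Rightarrow> i x | Inr y \<Rightarrow> j y)" for p
  have lk: "l (k z) = z" if "z \<in> W" for z
    using that by (auto simp: W_def k_def l_def f_inv_into_f)
  have WZ: "W \<subseteq> mspace Z"
    using i j by (auto simp: W_def isometric_embedding_def)
  interpret K: Metric_space "k ` W" "\<lambda>p q. mdist Z (l p) (l q)"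
  proof
    fix x y z
    show "0 \<le> mdist Z (l x) (l y)" by simp
    show "mdist Z (l x) (l y) = mdist Z (l y) (l x)" by (simp add: mdist_commute)
    show "mdist Z (l x) (l y) = 0 \<longleftrightarrow> x = y" if "x \<in> k ` W" "y \<in> k ` W"
      using that WZ lk by (auto simp: subset_iff)
    show "mdist Z (l x) (l z) \<le> mdist Z (l x) (l y) + mdist Z (l y) (l z)"
      if "x \<in> k ` W" "y \<in> k ` W" "z \<in> k ` W"
      using that WZ lk by (auto simp: subset_iff intro!: mdist_triangle)
  qed
  define Z' where "Z' = metric (k ` W, \<lambda>p q. mdist Z (l p) (l q))"
  have sp: "mspace Z' = k ` W" and di: "mdist Z' = (\<lambda>p q. mdist Z (l p) (l q))"
    by (simp_all add: Z'_def)
  have iW: "i x \<in> W" if "x \<in> mspace X" for x using that by (auto simp: W_def)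
  have jW: "j y \<in> W" if "y \<in> mspace Y" for y using that by (auto simp: W_def)
  have "isometric_embedding X Z' (k \<circ> i)" "isometric_embedding Y Z' (k \<circ> j)"
    using i j by (auto simp: isometric_embedding_def sp di lk iW jW)
  moreover have "hausdorff_dist Z' ((k \<circ> i) ` mspace X) ((k \<circ> j) ` mspace Y)
      = hausdorff_dist Z (i ` mspace X) (j ` mspace Y)"
    unfolding hausdorff_dist_def di image_image comp_apply
    by (intro arg_cong2[where f = max] SUP_cong INF_cong refl) (simp_all add: lk iW jW)
  ultimately show ?thesis
    unfolding gh_dist_def by (intro Inf_lower) force
qed

definition bi_katetov :: "'a metric \<Rightarrow> 'b metric \<Rightarrow> ('a \<Rightarrow> 'b \<Rightarrow> real) \<Rightarrow> bool" where
  "bi_katetov X Y f \<longleftrightarrow>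
     (\<forall>x\<in>mspace X. \<forall>w\<in>mspace X. \<forall>y\<in>mspace Y. \<bar>f x y - f w y\<bar> \<le> mdist X x w) \<and>
     (\<forall>x\<in>mspace X. \<forall>y\<in>mspace Y. \<forall>z\<in>mspace Y. \<bar>f x y - f x z\<bar> \<le> mdist Y y z) \<and>
     (\<forall>x\<in>mspace X. \<forall>w\<in>mspace X. \<forall>y\<in>mspace Y. mdist X x w \<le> f x y + f w y) \<and>
     (\<forall>x\<in>mspace X. \<forall>y\<in>mspace Y. \<forall>z\<in>mspace Y. mdist Y y z \<le> f x y + f x z)"

text \<open>Tuples are lists, so \<open>n\<close> is the common length of the two lists. A bi-Katetov function is
  nonnegative, hence \<^const>\<open>ennreal\<close> loses nothing.\<close>

definition r_zero :: "'a metric \<Rightarrow> 'b metric \<Rightarrow> 'a list \<Rightarrow> 'b list \<Rightarrow> ennreal" where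
  "r_zero A B as bs =
     (INF f\<in>{f. bi_katetov (submetric A (set as)) (submetric B (set bs)) f}.
        SUP i\<in>{..<length as}. ennreal (f (as ! i) (bs ! i)))"

text \<open>Ordinals are the elements of an arbitrary well-ordered type; such an element stands for the
  order type of its set of predecessors, so \<open>0\<close> is the least element. Every ordinal arises from a
  suitable type. The successor is a relation since the type may have a greatest element.\<close>

definition is_succ :: "'o::wellorder \<Rightarrow> 'o \<Rightarrow> bool" where
  "is_succ \<alpha> \<alpha>' \<longleftrightarrow> \<alpha> < \<alpha>' \<and> (\<forall>\<gamma>. \<alpha> < \<gamma> \<longrightarrow> \<alpha>' \<le> \<gamma>)"

lemma is_succ_unique: "is_succ \<beta> \<alpha> \<Longrightarrow> is_succ \<gamma> \<alpha> \<Longrightarrow> \<beta> = \<gamma>"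
  unfolding is_succ_def by (meson leD linorder_neqE)

lemma the_is_succ: "is_succ \<beta> \<alpha> \<Longrightarrow> (THE \<gamma>. is_succ \<gamma> \<alpha>) = \<beta>"
  by (blast intro: is_succ_unique)

lemma the_is_succ_less: "is_succ \<beta> \<alpha> \<Longrightarrow> (THE \<gamma>. is_succ \<gamma> \<alpha>) < \<alpha>"
  by (simp add: the_is_succ) (simp add: is_succ_def)

text \<open>The three clauses of the recursion are the lemmas \<open>r_dist_zero\<close>, \<open>r_dist_succ\<close> and
  \<open>r_dist_limit\<close>.\<close>

function r_dist :: "'a metric \<Rightarrow> 'b metric \<Rightarrow> 'o::wellorder \<Rightarrow> 'a list \<Rightarrow> 'b list \<Rightarrow> ennreal" where
  "r_dist A B \<alpha> as bs =
     (if \<exists>\<beta>. is_succ \<beta> \<alpha> then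
        max (SUP x\<in>mspace A. INF y\<in>mspace B. r_dist A B (THE \<beta>. is_succ \<beta> \<alpha>) (as @ [x]) (bs @ [y]))
            (SUP y\<in>mspace B. INF x\<in>mspace A. r_dist A B (THE \<beta>. is_succ \<beta> \<alpha>) (as @ [x]) (bs @ [y]))
      else if \<exists>\<beta>. \<beta> < \<alpha> then (SUP \<beta>\<in>{..<\<alpha>}. r_dist A B \<beta> as bs)
      else r_zero A B as bs)"
  by pat_completeness auto
termination
proof (relation "inv_image {(x, y). x < y} (\<lambda>(A, B, \<alpha>, as, bs). \<alpha>)",
       goal_cases)
  case 1
  show ?case by (rule wf_inv_image, rule wf)
next
  case 2
  then show ?case by (auto dest: the_is_succ_less)
next
  case 3
  then show ?case by (auto dest: the_is_succ_less)
next
  case 4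
  then show ?case by simp
qed

declare r_dist.simps [simp del]

lemma r_dist_zero:
  assumes "\<And>\<beta>. \<alpha> \<le> \<beta>"
  shows "r_dist A B \<alpha> as bs = r_zero A B as bs"
  using assms by (subst r_dist.simps) (auto simp: is_succ_def not_less[symmetric])

lemma r_dist_succ:
  assumes "is_succ \<alpha> \<alpha>'"
  shows "r_dist A B \<alpha>' as bs =
     max (SUP x\<in>mspace A. INF y\<in>mspace B. r_dist A B \<alpha> (as @ [x]) (bs @ [y]))
         (SUP y\<in>mspace B. INF x\<in>mspace A. r_dist A B \<alpha> (as @ [x]) (bs @ [y]))"
  using assms by (subst r_dist.simps) (auto simp: the_is_succ)

lemma r_dist_limit:
  assumes "\<beta> < \<alpha>" and "\<nexists>\<gamma>. is_succ \<gamma> \<alpha>"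
  shows "r_dist A B \<alpha> as bs = (SUP \<beta>\<in>{..<\<alpha>}. r_dist A B \<beta> as bs)"
  using assms by (subst r_dist.simps) auto

end

theory Submission
  imports Defs
begin

text \<open>For a metric space containing both \<open>A\<close> and \<open>B\<close>, transfinite induction bounds
  \<open>r\<^sub>\<beta>(as, bs)\<close> by the maximum of the Hausdorff distance and the distances between
  corresponding entries, so \<open>r\<^sub>\<alpha>\<close> at the empty tuples is at most the Gromov--Hausdorff distance.

  Conversely let \<open>r\<^sub>\<alpha> < D\<close> at the empty tuples. As \<open>r\<^sub>\<alpha>\<close> is a fixed point of the successor
  step, a back-and-forth along countable dense sets extends the tuples indefinitely while
  keeping \<open>r\<^sub>\<alpha> < D\<close>, hence \<open>r\<^sub>0 < D\<close>. The resulting relation between \<open>A\<close> and \<open>B\<close> has dense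
  projections and distortion at most \<open>2 D\<close>. Declaring related points to have distance \<open>D\<close>
  generates a metric on the disjoint union whose Hausdorff distance is at most \<open>D\<close>. Using the
  distortion instead of the bi-Katetov functions avoids a compactness argument.\<close>

section \<open>Bi-Katetov functions and correspondences\<close>

text \<open>All four conditions are triangle inequalities in \<open>Z\<close>. This supplies the
  competitor for \<open>r_zero\<close> when a common space is given.\<close>

lemma bi_katetov_isometric_embeddings:
  assumes "isometric_embedding X Z i" "isometric_embedding Y Z j"
  shows "bi_katetov X Y (\<lambda>x y. mdist Z (i x) (j y))"
proof -
  have tri: "\<bar>mdist Z u w - mdist Z v w\<bar> \<le> mdist Z u v" "mdist Z u v \<le> mdist Z u w + mdist Z v w"
    "\<bar>mdist Z w u - mdist Z w v\<bar> \<le> mdist Z u v" "mdist Z u v \<le> mdist Z w u + mdist Z w v"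
    if "u \<in> mspace Z" "v \<in> mspace Z" "w \<in> mspace Z" for u v w
    using that mdist_triangle[of u Z v w] mdist_triangle[of v Z u w] mdist_triangle[of u Z w v]
    by (auto simp: mdist_commute)
  have iZ: "i x \<in> mspace Z" if "x \<in> mspace X" for x
    using that assms by (auto simp: isometric_embedding_def)
  have jZ: "j y \<in> mspace Z" if "y \<in> mspace Y" for y
    using that assms by (auto simp: isometric_embedding_def)
  have iD: "mdist X x w = mdist Z (i x) (i w)" if "x \<in> mspace X" "w \<in> mspace X" for x w
    using that assms by (auto simp: isometric_embedding_def)
  have jD: "mdist Y x w = mdist Z (j x) (j w)" if "x \<in> mspace Y" "w \<in> mspace Y" for x w
    using that assms by (auto simp: isometric_embedding_def)
  show ?thesis
    unfolding bi_katetov_def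
    using tri iZ jZ by (auto simp: iD jD)
qed

lemma bi_katetov_submetric_mono:
  assumes "bi_katetov (submetric A S') (submetric B T') f" "S \<subseteq> S'" "T \<subseteq> T'"
  shows "bi_katetov (submetric A S) (submetric B T) f"
  using assms unfolding bi_katetov_def by (simp add: subset_iff)

text \<open>Each mixed triangle inequality is one of the bi-Katetov conditions. Positivity keeps
  points of \<open>X\<close> apart from points of \<open>Y\<close>; it ranges over all arguments
  because \<open>Metric_space\<close> demands nonnegativity on the whole type.\<close>

lemma Metric_space_bi_katetov:
  assumes bk: "bi_katetov X Y f" and pos: "\<And>x y. 0 < f x y"
  shows "Metric_space (mspace X <+> mspace Y)
    (\<lambda>p q. case p of Inl x \<Rightarrow> (case q of Inl w \<Rightarrow> mdist X x w | Inr y \<Rightarrow> f x y)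
                   | Inr y \<Rightarrow> (case q of Inl x \<Rightarrow> f x y | Inr z \<Rightarrow> mdist Y y z))"
    (is "Metric_space ?M ?d")
proof
  have L1: "f x y \<le> mdist X x w + f w y" "f x y \<le> f w y + mdist X w x"
    and L2: "mdist X x w \<le> f x y + f w y"
    if "x \<in> mspace X" "w \<in> mspace X" "y \<in> mspace Y" for x w y
    using that bk unfolding bi_katetov_def
    by (auto simp: mdist_commute[of X w x] abs_le_iff algebra_simps)
  have R1: "f x y \<le> f x z + mdist Y z y" "f x y \<le> mdist Y y z + f x z"
    and R2: "mdist Y y z \<le> f x y + f x z"
    if "x \<in> mspace X" "y \<in> mspace Y" "z \<in> mspace Y" for x y z
    using that bk unfolding bi_katetov_def
    by (auto simp: mdist_commute[of Y z y] abs_le_iff algebra_simps)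
  fix p q s
  show "0 \<le> ?d p q" using pos by (auto split: sum.splits intro: less_imp_le)
  show "?d p q = ?d q p" by (auto simp: mdist_commute split: sum.splits)
  show "?d p q = 0 \<longleftrightarrow> p = q" if "p \<in> ?M" "q \<in> ?M"
    using that less_imp_neq[OF pos] by auto
  show "?d p s \<le> ?d p q + ?d q s" if "p \<in> ?M" "q \<in> ?M" "s \<in> ?M"
    using that by (auto intro: mdist_triangle L1 L2 R1 R2)
qed

text \<open>Glue the two spaces along \<open>f\<close>. Partners up to an error \<open>e\<close>
  suffice because the Hausdorff distance is built from infima.\<close>

lemma gh_dist_le_bi_katetov:
  assumes bk: "bi_katetov X Y f" and pos: "\<And>x y. 0 < f x y"
    and X: "\<And>x e. x \<in> mspace X \<Longrightarrow> 0 < e \<Longrightarrow> \<exists>y\<in>mspace Y. f x y \<le> D + e"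
    and Y: "\<And>y e. y \<in> mspace Y \<Longrightarrow> 0 < e \<Longrightarrow> \<exists>x\<in>mspace X. f x y \<le> D + e"
    and D: "0 \<le> D"
  shows "gh_dist X Y \<le> ennreal D"
proof -
  define d where "d p q = (case p of Inl x \<Rightarrow> (case q of Inl w \<Rightarrow> mdist X x w | Inr y \<Rightarrow> f x y)
                   | Inr y \<Rightarrow> (case q of Inl x \<Rightarrow> f x y | Inr z \<Rightarrow> mdist Y y z))" for p q
  interpret Metric_space "mspace X <+> mspace Y" d
    unfolding d_def using bk pos by (rule Metric_space_bi_katetov)
  define Z where "Z = metric (mspace X <+> mspace Y, d)"
  have Z: "mspace Z = mspace X <+> mspace Y" "mdist Z = d"
    by (simp_all add: Z_def)
  have "gh_dist X Y \<le> hausdorff_dist Z (Inl ` mspace X) (Inr ` mspace Y)"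
    by (rule gh_dist_le_hausdorff_dist) (auto simp: isometric_embedding_def Z d_def)
  also have "\<dots> \<le> ennreal D"
  proof -
    have "(INF y\<in>mspace Y. ennreal (f x y)) \<le> ennreal D" if x: "x \<in> mspace X" for x
    proof (rule ennreal_le_epsilon)
      fix e :: real assume e: "0 < e"
      then obtain y where "y \<in> mspace Y" "f x y \<le> D + e" using X x by blast
      then show "(INF y\<in>mspace Y. ennreal (f x y)) \<le> ennreal D + ennreal e"
        using D e by (intro INF_lower2[of y]) (auto simp flip: ennreal_plus intro: ennreal_leI)
    qed
    moreover have "(INF x\<in>mspace X. ennreal (f x y)) \<le> ennreal D" if y: "y \<in> mspace Y" for y
    proof (rule ennreal_le_epsilon)
      fix e :: real assume e: "0 < e"
      then obtain x where "x \<in> mspace X" "f x y \<le> D + e" using Y y by blast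
      then show "(INF x\<in>mspace X. ennreal (f x y)) \<le> ennreal D + ennreal e"
        using D e by (intro INF_lower2[of x]) (auto simp flip: ennreal_plus intro: ennreal_leI)
    qed
    ultimately show ?thesis
      by (auto simp: hausdorff_dist_def Z d_def image_image intro!: SUP_least)
  qed
  finally show ?thesis .
qed

text \<open>Join each related pair by an edge of length \<open>D\<close>; \<open>f\<close> is the
  resulting path distance between the two sides. A detour through the other space crosses two edges,
  whose total \<open>2 * D\<close> pays for the distortion.\<close>

lemma gh_dist_le_correspondence:
  assumes R: "R \<subseteq> mspace X \<times> mspace Y" "R \<noteq> {}" and D: "0 < D"
    and dis: "\<And>a b a' b'. (a, b) \<in> R \<Longrightarrow> (a', b') \<in> R \<Longrightarrow> \<bar>mdist X a a' - mdist Y b b'\<bar> \<le> 2 * D"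
    and X: "\<And>x e. x \<in> mspace X \<Longrightarrow> 0 < e \<Longrightarrow> \<exists>(a, b)\<in>R. mdist X x a < e"
    and Y: "\<And>y e. y \<in> mspace Y \<Longrightarrow> 0 < e \<Longrightarrow> \<exists>(a, b)\<in>R. mdist Y b y < e"
  shows "gh_dist X Y \<le> ennreal D"
proof -
  define f where "f x y = (INF (a, b)\<in>R. mdist X x a + D + mdist Y b y)" for x y
  have bdd: "bdd_below ((\<lambda>(a, b). mdist X x a + D + mdist Y b y) ` R)" for x y
    using D by (intro bdd_belowI[of _ 0]) auto
  have f_le: "f x y \<le> mdist X x a + D + mdist Y b y" if "(a, b) \<in> R" for x y a b
    using cINF_lower[OF bdd that] by (simp add: f_def)
  have f_ge: "c \<le> f x y" if "\<And>a b. (a, b) \<in> R \<Longrightarrow> c \<le> mdist X x a + D + mdist Y b y" for c x y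
    unfolding f_def using R that by (intro cINF_greatest) auto
  have "f x y \<ge> D" for x y by (rule f_ge) auto
  with D have pos: "0 < f x y" for x y by (meson less_le_trans)
  have RXY: "a \<in> mspace X" "b \<in> mspace Y" if "(a, b) \<in> R" for a b using R that by auto
  have L1: "f x y \<le> f w y + mdist X x w"
    if "x \<in> mspace X" "w \<in> mspace X" "y \<in> mspace Y" for x w y
  proof -
    \<comment> \<open>With the other terms moved to the left, the claim is a lower bound for a
      single infimum, as \<open>f_ge\<close> requires.\<close>
    have "f x y - mdist X x w \<le> f w y"
    proof (rule f_ge)
      fix a b assume ab: "(a, b) \<in> R"
      show "f x y - mdist X x w \<le> mdist X w a + D + mdist Y b y"
        using f_le[OF ab, of x y] mdist_triangle[of x X w a] that RXY[OF ab] by simp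
    qed
    then show ?thesis by simp
  qed
  have R1: "f x y \<le> f x z + mdist Y y z"
    if "x \<in> mspace X" "y \<in> mspace Y" "z \<in> mspace Y" for x y z
  proof -
    have "f x y - mdist Y y z \<le> f x z"
    proof (rule f_ge)
      fix a b assume ab: "(a, b) \<in> R"
      show "f x y - mdist Y y z \<le> mdist X x a + D + mdist Y b z"
        using f_le[OF ab, of x y] mdist_triangle[of b Y z y] that RXY[OF ab]
        by (simp add: mdist_commute)
    qed
    then show ?thesis by simp
  qed
  have L2: "mdist X x w \<le> f x y + f w y"
    if "x \<in> mspace X" "w \<in> mspace X" "y \<in> mspace Y" for x w y
  proof -
    have "mdist X x w - f w y \<le> f x y"
    proof (rule f_ge)
      fix a b assume ab: "(a, b) \<in> R"
      have "mdist X x w - (mdist X x a + D + mdist Y b y) \<le> f w y"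
      proof (rule f_ge)
        fix a' b' assume ab': "(a', b') \<in> R"
        \<comment> \<open>Follow \<open>x\<close>, \<open>a\<close>, \<open>a'\<close>,
          \<open>w\<close>: the middle leg is at most \<open>mdist Y b b' + 2 * D\<close>, and
          \<open>b\<close> reaches \<open>b'\<close> through \<open>y\<close>.\<close>
        show "mdist X x w - (mdist X x a + D + mdist Y b y) \<le> mdist X w a' + D + mdist Y b' y"
          using dis[OF ab ab'] mdist_triangle[of x X a w] mdist_triangle[of a X a' w]
            mdist_triangle[of b Y y b'] that RXY[OF ab] RXY[OF ab']
          by (simp add: mdist_commute[of X a' w] mdist_commute[of Y y b'])
      qed
      then show "mdist X x w - f w y \<le> mdist X x a + D + mdist Y b y" by simp
    qed
    then show ?thesis by simp
  qed
  have R2: "mdist Y y z \<le> f x y + f x z"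
    if "x \<in> mspace X" "y \<in> mspace Y" "z \<in> mspace Y" for x y z
  proof -
    have "mdist Y y z - f x z \<le> f x y"
    proof (rule f_ge)
      fix a b assume ab: "(a, b) \<in> R"
      have "mdist Y y z - (mdist X x a + D + mdist Y b y) \<le> f x z"
      proof (rule f_ge)
        fix a' b' assume ab': "(a', b') \<in> R"
        show "mdist Y y z - (mdist X x a + D + mdist Y b y) \<le> mdist X x a' + D + mdist Y b' z"
          using dis[OF ab ab'] mdist_triangle[of y Y b z] mdist_triangle[of b Y b' z]
            mdist_triangle[of a X x a'] that RXY[OF ab] RXY[OF ab']
          by (simp add: mdist_commute[of X a x] mdist_commute[of Y y b])
      qed
      then show "mdist Y y z - f x z \<le> mdist X x a + D + mdist Y b y" by simp
    qed
    then show ?thesis by simp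
  qed
  have "bi_katetov X Y f"
    unfolding bi_katetov_def abs_le_iff
    using L1 L2 R1 R2 by (auto simp: algebra_simps mdist_commute) (metis mdist_commute)+
  then show ?thesis
  proof (rule gh_dist_le_bi_katetov)
    show "0 < f x y" for x y by (rule pos)
    show "0 \<le> D" using D by simp
    fix e :: real assume e: "0 < e"
    show "\<exists>y\<in>mspace Y. f x y \<le> D + e" if x: "x \<in> mspace X" for x
    proof -
      obtain a b where ab: "(a, b) \<in> R" "mdist X x a < e" using X[OF x e] by auto
      \<comment> \<open>The point \<open>b\<close> itself serves as partner, since the term
        \<open>mdist Y b b\<close> vanishes.\<close>
      then show ?thesis using f_le[OF ab(1), of x b] RXY[OF ab(1)]
        by (intro bexI[of _ b]) (auto simp: iffD2[OF mdist_zero])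
    qed
    show "\<exists>x\<in>mspace X. f x y \<le> D + e" if y: "y \<in> mspace Y" for y
    proof -
      obtain a b where ab: "(a, b) \<in> R" "mdist Y b y < e" using Y[OF y e] by auto
      then show ?thesis using f_le[OF ab(1), of a y] RXY[OF ab(1)]
        by (intro bexI[of _ a]) (auto simp: iffD2[OF mdist_zero])
    qed
  qed
qed

section \<open>The transfinite distances\<close>

text \<open>A bi-Katetov function for the longer tuples restricts to the shorter ones, where the
  maximum runs over fewer pairs. The length condition makes the indices below
  \<open>length as\<close> point into \<open>bs\<close>.\<close>

lemma r_zero_append:
  assumes "length as \<le> length bs"
  shows "r_zero A B as bs \<le> r_zero A B (as @ as') (bs @ bs')"
  unfolding r_zero_def
proof (rule INF_greatest)
  fix f assume "f \<in> {f. bi_katetov (submetric A (set (as @ as'))) (submetric B (set (bs @ bs'))) f}"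
  then have "bi_katetov (submetric A (set as)) (submetric B (set bs)) f"
    by (auto intro: bi_katetov_submetric_mono)
  then show "(INF f\<in>{f. bi_katetov (submetric A (set as)) (submetric B (set bs)) f}.
      SUP i\<in>{..<length as}. ennreal (f (as ! i) (bs ! i)))
    \<le> (SUP i\<in>{..<length (as @ as')}. ennreal (f ((as @ as') ! i) ((bs @ bs') ! i)))"
    using assms by (intro INF_lower2[of f] SUP_mono) (auto simp: nth_append intro!: bexI)
qed

text \<open>If \<open>f\<close> is below \<open>D\<close> on the pairs, then \<open>mdist A a a'
  \<le> f a b' + f a' b' \<le> f a b + mdist B b b' + f a' b'\<close>, and symmetrically.\<close>

lemma r_zero_less_imp_distortion:
  assumes r: "r_zero A B as bs < ennreal D"
    and AB: "length as = length bs" "set as \<subseteq> mspace A" "set bs \<subseteq> mspace B"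
    and ab: "(a, b) \<in> set (zip as bs)" "(a', b') \<in> set (zip as bs)"
  shows "\<bar>mdist A a a' - mdist B b b'\<bar> \<le> 2 * D"
proof -
  obtain f where bk: "bi_katetov (submetric A (set as)) (submetric B (set bs)) f"
    and f: "(SUP i\<in>{..<length as}. ennreal (f (as ! i) (bs ! i))) < ennreal D"
    using r by (auto simp: r_zero_def INF_less_iff)
  have fD: "f x y < D" if xy: "(x, y) \<in> set (zip as bs)" for x y
  proof -
    have "ennreal (f x y) < ennreal D"
      using xy AB(1) by (intro le_less_trans[OF _ f]) (auto simp: set_zip intro!: SUP_upper2)
    then show ?thesis by (meson ennreal_leI not_le)
  qed
  have mem: "a \<in> set as" "a' \<in> set as" "b \<in> set bs" "b' \<in> set bs"
    using ab by (auto dest: set_zip_leftD set_zip_rightD)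
  have "mdist A a a' \<le> f a b' + f a' b'" "\<bar>f a b - f a b'\<bar> \<le> mdist B b b'"
    "mdist B b b' \<le> f a' b + f a' b'" "\<bar>f a b - f a' b\<bar> \<le> mdist A a a'"
    using bk mem AB unfolding bi_katetov_def by (auto simp: subset_iff)
  then show ?thesis using fD[OF ab(1)] fD[OF ab(2)] by linarith
qed

text \<open>In the successor step the induction hypothesis meets longer tuples, whose
  \<open>r_zero\<close> is no smaller. A point of \<open>A\<close> keeps the outer supremum from
  being empty and hence 0.\<close>

lemma r_zero_le_r_dist:
  assumes ne: "mspace A \<noteq> {}" and len: "length as = length bs"
  shows "r_zero A B as bs \<le> r_dist A B \<alpha> as bs"
  using len
proof (induction \<alpha> arbitrary: as bs rule: less_induct)
  case (less \<alpha>)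
  consider (succ) \<beta> where "is_succ \<beta> \<alpha>" | (limit) \<beta> where "\<beta> < \<alpha>" "\<nexists>\<gamma>. is_succ \<gamma> \<alpha>"
    | (zero) "\<And>\<beta>. \<alpha> \<le> \<beta>" by (meson not_le)
  then show ?case
  proof cases
    case succ
    obtain x where x: "x \<in> mspace A" using ne by auto
    have "\<beta> < \<alpha>" using succ by (simp add: is_succ_def)
    then have "r_zero A B as bs \<le> r_dist A B \<beta> (as @ [x]) (bs @ [y])" for y
      using less.IH[of \<beta> "as @ [x]" "bs @ [y]"] r_zero_append[of as bs A B "[x]" "[y]"] less.prems
      by (auto intro: order_trans)
    then have "r_zero A B as bs \<le> (SUP x\<in>mspace A. INF y\<in>mspace B. r_dist A B \<beta> (as @ [x]) (bs @ [y]))"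
      by (intro SUP_upper2[OF x] INF_greatest)
    then show ?thesis by (simp add: r_dist_succ[OF succ] le_max_iff_disj)
  next
    case limit
    then show ?thesis using less by (auto simp: r_dist_limit intro!: SUP_upper2[of \<beta>])
  next
    case zero
    then show ?thesis by (simp add: r_dist_zero)
  qed
qed

section \<open>Upper bound by the Gromov-Hausdorff distance\<close>

text \<open>Appending a pair costs only its distance in \<open>Z\<close>, and the Hausdorff distance
  controls the best such cost. The bound \<open>c\<close> varies in the induction because a single
  candidate partner may lie farther away than \<open>c\<close>.\<close>

lemma r_dist_le_hausdorff_dist:
  assumes i: "isometric_embedding A Z i" and j: "isometric_embedding B Z j"
    and H: "hausdorff_dist Z (i ` mspace A) (j ` mspace B) \<le> c"
    and len: "length as = length bs"
    and c: "\<And>a b. (a, b) \<in> set (zip as bs) \<Longrightarrow> ennreal (mdist Z (i a) (j b)) \<le> c"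
  shows "r_dist A B \<alpha> as bs \<le> c"
  using H len c
proof (induction \<alpha> arbitrary: as bs c rule: less_induct)
  case (less \<alpha>)
  consider (succ) \<beta> where "is_succ \<beta> \<alpha>" | (limit) \<beta> where "\<beta> < \<alpha>" "\<nexists>\<gamma>. is_succ \<gamma> \<alpha>"
    | (zero) "\<And>\<beta>. \<alpha> \<le> \<beta>" by (meson not_le)
  then show ?case
  proof cases
    case succ
    then have "\<beta> < \<alpha>" by (simp add: is_succ_def)
    let ?d = "\<lambda>x y. ennreal (mdist Z (i x) (j y))"
    have H': "(INF y\<in>mspace B. ?d x y) \<le> c" if "x \<in> mspace A" for x
      using that less.prems(1) by (auto simp: hausdorff_dist_def image_image SUP_le_iff)
    have H'': "(INF x\<in>mspace A. ?d x y) \<le> c" if "y \<in> mspace B" for y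
      using that less.prems(1) by (auto simp: hausdorff_dist_def image_image SUP_le_iff)
    \<comment> \<open>The enlarged bound also covers the new pair.\<close>
    have step: "r_dist A B \<beta> (as @ [x]) (bs @ [y]) \<le> sup c (?d x y)" for x y
      using less.prems \<open>\<beta> < \<alpha>\<close> by (intro less.IH) (auto intro: le_supI1)
    have "(INF y\<in>mspace B. r_dist A B \<beta> (as @ [x]) (bs @ [y])) \<le> c" if "x \<in> mspace A" for x
    proof -
      have "(INF y\<in>mspace B. r_dist A B \<beta> (as @ [x]) (bs @ [y])) \<le> (INF y\<in>mspace B. sup c (?d x y))"
        by (intro INF_mono') (rule step)
      \<comment> \<open>Binary suprema distribute over infima in \<open>ennreal\<close>, so the
        enlargement disappears in the limit of better partners.\<close>
      also have "\<dots> = sup c (INF y\<in>mspace B. ?d x y)" by (simp add: sup_INF)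
      also have "\<dots> \<le> c" using H'[OF that] by simp
      finally show ?thesis .
    qed
    moreover have "(INF x\<in>mspace A. r_dist A B \<beta> (as @ [x]) (bs @ [y])) \<le> c" if "y \<in> mspace B" for y
    proof -
      have "(INF x\<in>mspace A. r_dist A B \<beta> (as @ [x]) (bs @ [y])) \<le> (INF x\<in>mspace A. sup c (?d x y))"
        by (intro INF_mono') (rule step)
      also have "\<dots> = sup c (INF x\<in>mspace A. ?d x y)" by (simp add: sup_INF)
      also have "\<dots> \<le> c" using H''[OF that] by simp
      finally show ?thesis .
    qed
    ultimately show ?thesis by (simp add: r_dist_succ[OF succ] SUP_le_iff)
  next
    case limit
    then show ?thesis using less by (auto simp: r_dist_limit intro!: SUP_least)
  next
    case zero
    have "bi_katetov (submetric A (set as)) (submetric B (set bs)) (\<lambda>x y. mdist Z (i x) (j y))"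
      using i j by (intro bi_katetov_isometric_embeddings) (auto simp: isometric_embedding_def)
    then show ?thesis
      unfolding r_dist_zero[OF zero] r_zero_def using less.prems
      by (intro INF_lower2) (auto intro!: SUP_least simp: set_zip)
  qed
qed

lemma r_dist_le_gh_dist: "r_dist A B \<alpha> [] [] \<le> gh_dist A B"
  unfolding gh_dist_def by (rule Inf_greatest) (auto intro: r_dist_le_hausdorff_dist)

section \<open>Lower bound by back-and-forth\<close>

text \<open>Here \<open>\<rho>\<close> stands for \<open>r_dist A B \<alpha>\<close> at the fixed
  ordinal. Its successor inequality preserves the strict bound along the back-and-forth, and
  \<open>r_zero\<close> turns that bound into a distortion estimate.\<close>

lemma gh_dist_le_fixed_point:
  fixes A :: "'a metric" and B :: "'b metric" and \<rho> :: "'a list \<Rightarrow> 'b list \<Rightarrow> ennreal"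
  assumes sepA: "separable_space (mtopology_of A)" and sepB: "separable_space (mtopology_of B)"
    and neA: "mspace A \<noteq> {}" and neB: "mspace B \<noteq> {}"
    and zero: "\<And>as bs. length as = length bs \<Longrightarrow> r_zero A B as bs \<le> \<rho> as bs"
    and fp: "\<And>as bs. length as = length bs \<Longrightarrow> set as \<subseteq> mspace A \<Longrightarrow> set bs \<subseteq> mspace B \<Longrightarrow>
      max (SUP x\<in>mspace A. INF y\<in>mspace B. \<rho> (as @ [x]) (bs @ [y]))
          (SUP y\<in>mspace B. INF x\<in>mspace A. \<rho> (as @ [x]) (bs @ [y])) \<le> \<rho> as bs"
    and D: "\<rho> [] [] < ennreal D"
  shows "gh_dist A B \<le> ennreal D"
proof -
  have dense: "\<exists>p :: nat \<Rightarrow> 'c. range p \<subseteq> mspace M \<and> (\<forall>x\<in>mspace M. \<forall>e>0. \<exists>n. mdist M x (p n) < e)"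
    if sep: "separable_space (mtopology_of M)" and ne: "mspace M \<noteq> {}" for M :: "'c metric"
  proof -
    obtain U where U: "countable U" "U \<subseteq> mspace M" "mtopology_of M closure_of U = mspace M"
      using sep by (auto simp: separable_space_def)
    have cl: "\<exists>u\<in>U. mdist M x u < e" if "x \<in> mspace M" "0 < e" for x e
    proof -
      have "x \<in> Metric_space.mtopology (mspace M) (mdist M) closure_of U"
        using that U(3) by (simp add: mtopology_of_def)
      then show ?thesis
        using that by (auto simp: Metric_space.metric_closure_of Metric_space.in_mball)
    qed
    have "U \<noteq> {}" using U(3) ne by auto
    \<comment> \<open>If \<open>U\<close> is finite, the enumeration repeats points.\<close>
    then have "range (from_nat_into U) = U" using U(1) by (rule range_from_nat_into)
    with cl U(2) show ?thesis by (intro exI[of _ "from_nat_into U"]) (metis rangeE)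
  qed
  obtain p where p: "range p \<subseteq> mspace A" "\<And>x e. x \<in> mspace A \<Longrightarrow> 0 < e \<Longrightarrow> \<exists>n::nat. mdist A x (p n) < e"
    using dense[OF sepA neA] by blast
  obtain q where q: "range q \<subseteq> mspace B" "\<And>x e. x \<in> mspace B \<Longrightarrow> 0 < e \<Longrightarrow> \<exists>n::nat. mdist B x (q n) < e"
    using dense[OF sepB neB] by blast
  define good where "good s \<longleftrightarrow> (case s of (as, bs) \<Rightarrow> length as = length bs \<and> set as \<subseteq> mspace A \<and>
    set bs \<subseteq> mspace B \<and> \<rho> as bs < ennreal D)" for s
  have extA: "\<exists>y. good (as @ [x], bs @ [y])" if "good (as, bs)" "x \<in> mspace A" for as bs x
  proof -
    \<comment> \<open>Since the supremum is strictly below \<open>D\<close>, so is the infimum for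
      the given \<open>x\<close>, and some \<open>y\<close> then has a value below
      \<open>D\<close>.\<close>
    have "(SUP x\<in>mspace A. INF y\<in>mspace B. \<rho> (as @ [x]) (bs @ [y])) < ennreal D"
      using that fp[of as bs] by (auto simp: good_def)
    then have "(INF y\<in>mspace B. \<rho> (as @ [x]) (bs @ [y])) < ennreal D"
      using that(2) by (rule SUP_lessD)
    then show ?thesis using that by (auto simp: INF_less_iff good_def)
  qed
  have extB: "\<exists>x. good (as @ [x], bs @ [y])" if "good (as, bs)" "y \<in> mspace B" for as bs y
  proof -
    have "(SUP y\<in>mspace B. INF x\<in>mspace A. \<rho> (as @ [x]) (bs @ [y])) < ennreal D"
      using that fp[of as bs] by (auto simp: good_def)
    then have "(INF x\<in>mspace A. \<rho> (as @ [x]) (bs @ [y])) < ennreal D"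
      using that(2) by (rule SUP_lessD)
    then show ?thesis using that by (auto simp: INF_less_iff good_def)
  qed
  \<comment> \<open>One round appends two pairs: \<open>p n\<close> with a reply in
    \<open>B\<close>, then \<open>q n\<close> with a reply in \<open>A\<close>.\<close>
  define Q where "Q n s s' \<longleftrightarrow> (\<exists>x y. s' = (fst s @ [p n, x], snd s @ [y, q n]))" for n s s'
  have "\<exists>s. \<forall>n. good (s n) \<and> Q n (s n) (s (Suc n))"
  proof (rule dependent_nat_choice)
    show "\<exists>s. good s" using D by (intro exI[of _ "([], [])"]) (simp add: good_def)
    fix s n assume s: "good s"
    obtain as bs where "s = (as, bs)" by (cases s)
    moreover obtain y where "good (as @ [p n], bs @ [y])"
      using extA[of as bs "p n"] s p(1) \<open>s = _\<close> by auto
    moreover from this obtain x where "good ((as @ [p n]) @ [x], (bs @ [y]) @ [q n])"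
      using extB[of "as @ [p n]" "bs @ [y]" "q n"] q(1) by auto
    ultimately show "\<exists>s'. good s' \<and> Q n s s'" by (auto simp: Q_def)
  qed
  then obtain s where good: "\<And>n. good (s n)" and Q: "\<And>n. Q n (s n) (s (Suc n))" by blast
  define r where "r n = set (zip (fst (s n)) (snd (s n)))" for n
  have len: "length (fst (s n)) = length (snd (s n))" for n
    using good[of n] by (auto simp: good_def)
  have Suc: "\<exists>x y. r (Suc n) = r n \<union> {(p n, y), (x, q n)}" for n
    using Q[of n] len[of n] by (fastforce simp: Q_def r_def)
  then have "incseq r" by (intro incseq_SucI) blast
  have pq: "\<exists>b. (p n, b) \<in> \<Union> (range r)" "\<exists>a. (a, q n) \<in> \<Union> (range r)" for n
    using Suc[of n] by blast+
  have "0 < D" using D by (auto simp: ennreal_neg not_le intro: ccontr)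
  show ?thesis
  proof (rule gh_dist_le_correspondence)
    show "\<Union> (range r) \<subseteq> mspace A \<times> mspace B"
    proof (rule UN_least)
      fix n show "r n \<subseteq> mspace A \<times> mspace B"
        using good[of n]
        by (auto simp: good_def r_def split: prod.splits dest: set_zip_leftD set_zip_rightD)
    qed
    show "\<Union> (range r) \<noteq> {}" using pq by blast
    show "0 < D" by fact
    show "\<exists>(a, b)\<in>\<Union> (range r). mdist A x a < e" if "x \<in> mspace A" "0 < e" for x e
      using p(2)[OF that] pq by blast
    show "\<exists>(a, b)\<in>\<Union> (range r). mdist B b y < e" if "y \<in> mspace B" "0 < e" for y e
      using q(2)[OF that] pq by (metis (mono_tags, lifting) case_prodI mdist_commute)
    fix a b a' b' assume "(a, b) \<in> \<Union> (range r)" "(a', b') \<in> \<Union> (range r)"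
    then obtain m n where "(a, b) \<in> r m" "(a', b') \<in> r n" by auto
    \<comment> \<open>Both pairs occur at the later stage, so one bi-Katetov function serves them
      both.\<close>
    then have ab: "(a, b) \<in> r (max m n)" "(a', b') \<in> r (max m n)"
      using \<open>incseq r\<close> by (meson in_mono incseqD max.cobounded1 max.cobounded2)+
    let ?as = "fst (s (max m n))" and ?bs = "snd (s (max m n))"
    have "set ?as \<subseteq> mspace A" "set ?bs \<subseteq> mspace B" "\<rho> ?as ?bs < ennreal D"
      using good[of "max m n"] by (auto simp: good_def)
    then show "\<bar>mdist A a a' - mdist B b b'\<bar> \<le> 2 * D"
      using ab len unfolding r_def
      by (intro r_zero_less_imp_distortion[of A B ?as ?bs] le_less_trans[OF zero[OF len]]) auto
  qed
qed

theorem theorem19p8: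
  fixes A :: "'a metric" and B :: "'b metric" and \<alpha> \<alpha>' :: "'o::wellorder"
  assumes "separable_space (mtopology_of A)"
    and "separable_space (mtopology_of B)"
    and "Metric_space.mbounded (mspace A) (mdist A) (mspace A)"
    and "Metric_space.mbounded (mspace B) (mdist B) (mspace B)"
    and "is_succ \<alpha> \<alpha>'"
    and "\<And>n as bs. \<lbrakk>length as = n; length bs = n; set as \<subseteq> mspace A; set bs \<subseteq> mspace B\<rbrakk>
           \<Longrightarrow> r_dist A B \<alpha>' as bs = r_dist A B \<alpha> as bs"
  shows "r_dist A B \<alpha> [] [] = gh_dist A B"
proof (rule antisym)
  show "r_dist A B \<alpha> [] [] \<le> gh_dist A B" by (rule r_dist_le_gh_dist)
  have fp: "max (SUP x\<in>mspace A. INF y\<in>mspace B. r_dist A B \<alpha> (as @ [x]) (bs @ [y]))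
      (SUP y\<in>mspace B. INF x\<in>mspace A. r_dist A B \<alpha> (as @ [x]) (bs @ [y])) = r_dist A B \<alpha> as bs"
    if "length as = length bs" "set as \<subseteq> mspace A" "set bs \<subseteq> mspace B" for as bs
    using assms(6)[OF that(1) refl that(2,3)] r_dist_succ[OF assms(5), of A B as bs] by simp
  show "gh_dist A B \<le> r_dist A B \<alpha> [] []"
  proof (cases "mspace A = {} \<or> mspace B = {}")
    case True
    then consider "mspace A = {}" "mspace B = {}" | "mspace A = {}" "mspace B \<noteq> {}"
      | "mspace A \<noteq> {}" "mspace B = {}" by blast
    then show ?thesis
    proof cases
      case 1
      \<comment> \<open>Both suprema are empty, so this Hausdorff distance is 0. The second map has
        empty domain and may be arbitrary.\<close>
      have "gh_dist A B \<le> hausdorff_dist A (id ` mspace A) (undefined ` mspace B)"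
        by (rule gh_dist_le_hausdorff_dist) (auto simp: isometric_embedding_def 1)
      then show ?thesis by (simp add: hausdorff_dist_def 1 bot_ennreal)
    \<comment> \<open>With exactly one space empty, the fixed-point equation at the empty tuples
      contains an infimum over the empty set, so its value is infinite.\<close>
    qed (use fp[of "[]" "[]"] in \<open>simp_all add: max_def top_unique split: if_splits\<close>)
  next
    case False
    show ?thesis
    \<comment> \<open>Passing to every larger \<open>c\<close> provides the strict inequality that
      the back-and-forth preserves; an infinite \<open>c\<close> is trivial.\<close>
    proof (rule dense_ge)
      fix c assume c: "r_dist A B \<alpha> [] [] < c"
      show "gh_dist A B \<le> c"
      proof (cases c)
        case (real D)
        have "gh_dist A B \<le> ennreal D"
        proof (rule gh_dist_le_fixed_point[where \<rho> = "r_dist A B \<alpha>", OF assms(1,2)])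
          show "r_dist A B \<alpha> [] [] < ennreal D" using c real by simp
          show "r_zero A B as bs \<le> r_dist A B \<alpha> as bs" if "length as = length bs" for as bs
            using False that by (blast intro: r_zero_le_r_dist)
        qed (use False fp in auto)
        then show ?thesis by (simp add: real)
      qed simp
    qed
  qed
qed

end
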